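(* Let $X\subset\mathbb{R}^d$ be a finite data set, $k\ge 2$ an integer, $\varepsilon_1\in[0,1)$, $\varepsilon_2\ge 0$, and let $T_k$ be the set of $k$ centers sampled by noisy $k$-means++ with parameters $\varepsilon_1,\varepsilon_2$ on $X$ (against an arbitrary adversary). There is an absolute constant $c>0$ such that: (i) if $\frac{k}{\ln k}\ge \max\{18,\frac{24(\varepsilon_1+\varepsilon_2)(1+\varepsilon_2)}{(1-\varepsilon_1)^2}\}$, then $\mathbb{E}[\Phi(X,T_k)]\le c\left(\frac{1+\varepsilon_2}{1-\varepsilon_1}\right)^3\log^2(k)\,\mathrm{OPT}_k(X)$; (ii) if $\frac{k}{\ln k}\le \max\{18,\frac{24(\varepsilon_1+\varepsilon_2)(1+\varepsilon_2)}{(1-\varepsilon_1)^2}\}$, then $\mathbb{E}[\Phi(X,T_k)]\le c\left(\frac{1+\varepsilon_2}{1-\varepsilon_1}\right)^4\log^2\!\left(\frac{1+\varepsilon_2}{1-\varepsilon_1}\right)\mathrm{OPT}_k(X)$.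
   Context: $\Phi(X,C)=\sum_{x\in X}\min_{c\in C}\|x-c\|^2$ and $\mathrm{OPT}_k(X)=\min_{|C|=k}\Phi(X,C)$. Noisy $k$-means++ with parameters $\varepsilon_1\in[0,1)$, $\varepsilon_2\ge0$ selects $k$ centers from $X$ iteratively. In iteration $t$, let $p$ be the distribution that $k$-means++ would use: uniform on $X$ for $t=1$, and for $t\ge2$, $p_x=\Phi(x,C)/\Phi(X,C)$ where $C$ is the set of centers chosen so far. An adversary, who may depend arbitrarily on the history, chooses any probability distribution $q$ on $X$ with $(1-\varepsilon_1)p_x\le q_x\le(1+\varepsilon_2)p_x$ for all $x\in X$, and the next center is sampled according to $q$. $T_k$ is the set of the $k$ chosen centers.
   Formalization: In (ii), log²((1+ε₂)/(1−ε₁)) is replaced by max(1, ln((1+ε₂)/(1−ε₁)))²: as written, (ii) fails for ε₁=ε₂=0 (right side 0, but k=2, X={0,1,3} has OPT=1/2), and likewise as the ratio tends to 1. *)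

theory Defs
  imports "HOL-Probability.Probability"
begin

text \<open>
  The space \<open>\<real>\<^sup>d\<close> is the library's \<open>topspace (Euclidean_space d)\<close>, i.e. the functions
  \<open>nat \<Rightarrow> real\<close> vanishing from index \<open>d\<close> on. The dimension is a term rather than a type, so that
  a constant can be asserted to exist uniformly in \<open>d\<close>.
\<close>

definition kmeans_cost :: "nat \<Rightarrow> (nat \<Rightarrow> real) set \<Rightarrow> (nat \<Rightarrow> real) set \<Rightarrow> real" where
  "kmeans_cost d X C = (\<Sum>x\<in>X. MIN c\<in>C. (L2_set (\<lambda>i. x i - c i) {..<d})\<^sup>2)"

text \<open>
  Centers range over all of \<open>\<real>\<^sup>d\<close>. For \<open>d \<ge> 1\<close>, \<open>k \<ge> 1\<close> and finite \<open>X\<close> the infimum is over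
  a nonempty family of nonnegative reals and is attained.
\<close>

definition kmeans_opt :: "nat \<Rightarrow> nat \<Rightarrow> (nat \<Rightarrow> real) set \<Rightarrow> real" where
  "kmeans_opt d k X =
     (INF C\<in>{C. C \<subseteq> topspace (Euclidean_space d) \<and> finite C \<and> card C = k}. kmeans_cost d X C)"

text \<open>
  A history is the list of the centers chosen so far, in order. Meaningful if the history is empty
  (first iteration) or has nonzero cost.
\<close>

definition kmpp_prob ::
    "nat \<Rightarrow> (nat \<Rightarrow> real) set \<Rightarrow> (nat \<Rightarrow> real) list \<Rightarrow> (nat \<Rightarrow> real) \<Rightarrow> real" where
  "kmpp_prob d X h x =
     (if h = [] then 1 / real (card X)
      else kmeans_cost d {x} (set h) / kmeans_cost d X (set h))"

text \<open>
  If the current cost is zero, the \<open>k\<close>-means++ distribution \<open>0 / 0\<close> is undefined; any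
  distribution on \<open>X\<close> is then allowed (the cost stays zero whatever is chosen).
\<close>

definition noisy_adversary ::
    "nat \<Rightarrow> nat \<Rightarrow> real \<Rightarrow> real \<Rightarrow> (nat \<Rightarrow> real) set
      \<Rightarrow> ((nat \<Rightarrow> real) list \<Rightarrow> (nat \<Rightarrow> real) pmf) \<Rightarrow> bool" where
  "noisy_adversary d k \<epsilon>\<^sub>1 \<epsilon>\<^sub>2 X Q \<longleftrightarrow>
     (\<forall>h. length h < k \<and> set h \<subseteq> X \<longrightarrow>
        set_pmf (Q h) \<subseteq> X \<and>
        (h = [] \<or> kmeans_cost d X (set h) \<noteq> 0 \<longrightarrow>
          (\<forall>x\<in>X. (1 - \<epsilon>\<^sub>1) * kmpp_prob d X h x \<le> pmf (Q h) x \<and>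
                 pmf (Q h) x \<le> (1 + \<epsilon>\<^sub>2) * kmpp_prob d X h x)))"

primrec sample_centers :: "('a list \<Rightarrow> 'a pmf) \<Rightarrow> nat \<Rightarrow> 'a list pmf" where
  "sample_centers Q 0 = return_pmf []"
| "sample_centers Q (Suc t) =
     bind_pmf (sample_centers Q t) (\<lambda>h. map_pmf (\<lambda>x. h @ [x]) (Q h))"

definition noisy_kmpp :: "('a list \<Rightarrow> 'a pmf) \<Rightarrow> nat \<Rightarrow> 'a set pmf" where
  "noisy_kmpp Q k = map_pmf set (sample_centers Q k)"

definition noise_threshold :: "real \<Rightarrow> real \<Rightarrow> real" where
  "noise_threshold \<epsilon>\<^sub>1 \<epsilon>\<^sub>2 = max 18 (24 * (\<epsilon>\<^sub>1 + \<epsilon>\<^sub>2) * (1 + \<epsilon>\<^sub>2) / (1 - \<epsilon>\<^sub>1)\<^sup>2)"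

text \<open>
  Logarithm convention for asymptotic bounds: a logarithmic factor is understood to be at least 1.
  It matters for \<open>log ((1 + \<epsilon>\<^sub>2) / (1 - \<epsilon>\<^sub>1))\<close>, which would otherwise vanish in the noiseless case
  and make the upper bound zero.
\<close>

definition log_factor :: "real \<Rightarrow> real" where
  "log_factor r = max 1 (ln r)"

end

theory Submission imports Defs begin

text \<open>
  Write \<open>r = (1 + \<epsilon>\<^sub>2) / (1 - \<epsilon>\<^sub>1)\<close>. We bound the expected cost by \<open>O(r\<^sup>3 ln k) \<cdot> OPT\<close> for every
  \<open>k\<close>; this is stronger than (i), and it implies (ii) because there \<open>ln k = O(1 + ln r)\<close>.

  Fix \<open>k\<close> reference centers and their clusters. A cluster costs \<open>O(r)\<close> times its optimum in
  expectation once it is hit. The number of clusters never hit equals the number of repeats, i.e.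
  choices falling into a cluster that had been hit before, so each repeat is charged the final
  average cost of an uncovered cluster. A repeat at step \<open>t\<close> has probability at most
  \<open>(1 + \<epsilon>\<^sub>2) H / \<Phi>\<close>, where \<open>H\<close> is the cost of the covered clusters and \<open>\<Phi>\<close> the total cost.
  Its charge would be at most \<open>\<Phi> / (k - t)\<close> if the average did not increase, and the sum over
  \<open>t\<close> is then harmonic.

  The adversary can make the average cost of the uncovered clusters grow, but only by a factor
  \<open>O(r)\<close> altogether: if \<open>a\<close> is the average at step \<open>t\<close>, a cluster of cost above \<open>2 r a\<close> is always
  hit with at least the probability of one of cost at most \<open>2 a\<close>, so the total cost of the former,
  divided by one plus the number of the latter, is a supermartingale. The other clusters cost
  at most \<open>2 r a\<close>, and initially at least half of the clusters cost at most \<open>2 a\<close>.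
\<close>

section \<open>Squared distances and D^2 sampling in one cluster\<close>

definition sqdist :: "nat \<Rightarrow> (nat \<Rightarrow> real) \<Rightarrow> (nat \<Rightarrow> real) \<Rightarrow> real" where
  "sqdist d x y = (L2_set (\<lambda>i. x i - y i) {..<d})\<^sup>2"

lemma sqdist_nonneg [simp]: "0 \<le> sqdist d x y"
  by (simp add: sqdist_def)

lemma sqdist_eq_sum: "sqdist d x y = (\<Sum>i<d. (x i - y i)\<^sup>2)"
  by (simp add: sqdist_def L2_set_def sum_nonneg)

lemma sqdist_commute: "sqdist d x y = sqdist d y x"
  by (simp add: sqdist_eq_sum power2_commute)

lemma sqdist_triangle: "sqdist d x z \<le> 2 * sqdist d x y + 2 * sqdist d y z"
proof -
  have "(x i - z i)\<^sup>2 \<le> 2 * (x i - y i)\<^sup>2 + 2 * (y i - z i)\<^sup>2" for i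
    using sum_squares_bound[of "x i - y i" "y i - z i"] by (simp add: power2_eq_square algebra_simps)
  then show ?thesis
    by (simp add: sqdist_eq_sum sum_distrib_left flip: sum.distrib) (intro sum_mono)
qed

text \<open>Each pair is routed through \<open>c\<close>, which may be any point. At the centroid an
  exact identity holds with 2 in place of 4.\<close>

lemma sum_sqdist_pairs_le:
  assumes "finite A"
  shows "(\<Sum>x\<in>A. \<Sum>y\<in>A. sqdist d x y) \<le> 4 * real (card A) * (\<Sum>x\<in>A. sqdist d x c)"
proof -
  have "(\<Sum>x\<in>A. \<Sum>y\<in>A. sqdist d x y) \<le> (\<Sum>x\<in>A. \<Sum>y\<in>A. 2 * sqdist d x c + 2 * sqdist d y c)"
    by (intro sum_mono) (metis sqdist_triangle sqdist_commute)
  also have "\<dots> = 4 * real (card A) * (\<Sum>x\<in>A. sqdist d x c)"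
    by (simp add: sum.distrib algebra_simps flip: sum_distrib_left)
  finally show ?thesis .
qed

text \<open>After division by the sum of \<open>D\<close> this is the classical seeding lemma: a
  center drawn from \<open>A\<close> proportionally to \<open>D\<close> leaves an expected cost of
  at most 16 times the cost of \<open>A\<close> at \<open>c\<close>. The triangle inequality
  averaged over \<open>y\<close> bounds \<open>D x\<close> by twice the mean of \<open>D\<close>
  plus twice the mean distance from \<open>x\<close>.\<close>

lemma D2_sampling_cost:
  assumes "finite A" and D0: "\<And>x. 0 \<le> D x"
    and D: "\<And>x y. D x \<le> 2 * D y + 2 * sqdist d x y"
  shows "(\<Sum>x\<in>A. D x * (\<Sum>y\<in>A. min (D y) (sqdist d y x)))
           \<le> 16 * (\<Sum>x\<in>A. D x) * (\<Sum>x\<in>A. sqdist d x c)"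
proof (cases "A = {}")
  case False
  define n where "n = real (card A)"
  have n: "n > 0" using False assms(1) by (simp add: n_def card_gt_0_iff)
  define S where "S = (\<Sum>x\<in>A. D x)"
  define m where "m x = (\<Sum>y\<in>A. min (D y) (sqdist d y x))" for x
  define p where "p x = (\<Sum>y\<in>A. sqdist d x y)" for x
  have S0: "0 \<le> S" by (simp add: S_def sum_nonneg D0)
  have m0: "0 \<le> m x" for x by (simp add: m_def sum_nonneg D0)
  have p0: "0 \<le> p x" for x by (simp add: p_def sum_nonneg)
  have mS: "m x \<le> S" for x unfolding m_def S_def by (intro sum_mono) simp
  have mp: "m x \<le> p x" for x unfolding m_def p_def by (intro sum_mono) (simp add: sqdist_commute)
  have nD: "n * D x \<le> 2 * S + 2 * p x" for x
  proof -
    have "n * D x = (\<Sum>y\<in>A. D x)" by (simp add: n_def)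
    also have "\<dots> \<le> (\<Sum>y\<in>A. 2 * D y + 2 * sqdist d x y)" by (intro sum_mono D)
    finally show ?thesis by (simp add: S_def p_def sum.distrib sum_distrib_left)
  qed
  have step: "n * (D x * m x) \<le> 4 * S * p x" for x
  proof -
    have "n * (D x * m x) \<le> (2 * S + 2 * p x) * m x"
      using mult_right_mono[OF nD m0] by (simp add: mult.assoc)
    also have "\<dots> = 2 * S * m x + 2 * p x * m x" by (simp add: algebra_simps)
    \<comment> \<open>The first product uses \<open>m x \<le> p x\<close>, the second
      \<open>m x \<le> S\<close>, so both become multiples of \<open>S * p x\<close>.\<close>
    also have "\<dots> \<le> 2 * S * p x + 2 * p x * S"
      by (intro add_mono mult_left_mono mp mS) (simp_all add: S0 p0)
    finally show ?thesis by simp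
  qed
  have "n * (\<Sum>x\<in>A. D x * m x) \<le> (\<Sum>x\<in>A. 4 * S * p x)"
    unfolding sum_distrib_left by (intro sum_mono step)
  also have "\<dots> = 4 * S * (\<Sum>x\<in>A. p x)" by (simp add: sum_distrib_left)
  also have "\<dots> \<le> 4 * S * (4 * n * (\<Sum>x\<in>A. sqdist d x c))"
    unfolding p_def n_def using sum_sqdist_pairs_le[OF assms(1), of d c] S0
    by (intro mult_left_mono) simp_all
  finally have "n * (\<Sum>x\<in>A. D x * m x) \<le> n * (16 * S * (\<Sum>x\<in>A. sqdist d x c))"
    by (simp add: mult.assoc mult.left_commute)
  then show ?thesis using n by (simp add: m_def S_def)
qed simp

text \<open>A position of \<open>h\<close> either brings a new value of \<open>f\<close> or repeats
  an old one. Along a history of length \<open>k\<close> this makes the number of missed clusters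
  equal to the number of repeats.\<close>

lemma card_image_add_repeats:
  "card (f ` set h) + (\<Sum>t<length h. of_bool (f (h ! t) \<in> f ` set (take t h))) = length h"
proof (induction h rule: rev_induct)
  case (snoc x h)
  have "(\<Sum>t<length h. of_bool (f ((h @ [x]) ! t) \<in> f ` set (take t (h @ [x]))))
      = (\<Sum>t<length h. of_bool (f (h ! t) \<in> f ` set (take t h)) :: nat)"
    by (intro sum.cong) (simp_all add: nth_append)
  then show ?case using snoc by (auto simp: card_insert_if insert_absorb)
qed simp

section \<open>The sampling process relative to reference clusters\<close>

text \<open>Later \<open>C\<close> runs through all competing center sets, and \<open>f\<close>
  picks a nearest center.\<close>

locale noisy_seeding =
  fixes d k :: nat and X :: "(nat \<Rightarrow> real) set" and e1 e2 :: real
    and Q :: "(nat \<Rightarrow> real) list \<Rightarrow> (nat \<Rightarrow> real) pmf"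
    and C :: "(nat \<Rightarrow> real) set" and f :: "(nat \<Rightarrow> real) \<Rightarrow> nat \<Rightarrow> real"
  assumes finX: "finite X" and e1: "0 \<le> e1" "e1 < 1" and e2: "0 \<le> e2"
    and adv: "noisy_adversary d k e1 e2 X Q"
    and finC: "finite C" and cardC: "card C = k" and fC: "\<And>x. x \<in> X \<Longrightarrow> f x \<in> C"
begin

definition r :: real where "r = (1 + e2) / (1 - e1)"

lemma r_ge: "1 + e2 \<le> r" "1 \<le> r"
proof -
  have "(1 + e2) * (1 - e1) \<le> 1 + e2" using e1 e2 by (simp add: mult_left_le)
  then show "1 + e2 \<le> r" using e1 by (simp add: r_def pos_le_divide_eq)
  then show "1 \<le> r" using e2 by simp
qed

lemma r_mult: "(1 - e1) * r = 1 + e2"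
  using e1 by (simp add: r_def)

text \<open>For the empty history this is \<open>Min {}\<close>, an unspecified value, which is why
  sign and monotonicity of costs are stated for nonempty histories.\<close>

definition D :: "(nat \<Rightarrow> real) list \<Rightarrow> (nat \<Rightarrow> real) \<Rightarrow> real" where
  "D h x = (MIN c\<in>set h. sqdist d x c)"

definition cluster :: "(nat \<Rightarrow> real) \<Rightarrow> (nat \<Rightarrow> real) set" where
  "cluster c = {x \<in> X. f x = c}"

text \<open>The cost of the cluster at its reference center, which need not be its centroid. Summed
  over \<open>C\<close> it is the cost of \<open>C\<close> when \<open>f\<close> picks nearest
  centers.\<close>

definition opt :: "(nat \<Rightarrow> real) \<Rightarrow> real" where
  "opt c = (\<Sum>x\<in>cluster c. sqdist d x c)"

definition cost :: "(nat \<Rightarrow> real) list \<Rightarrow> (nat \<Rightarrow> real) \<Rightarrow> real" where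
  "cost h c = (\<Sum>x\<in>cluster c. D h x)"

definition uncovered :: "(nat \<Rightarrow> real) list \<Rightarrow> (nat \<Rightarrow> real) set" where
  "uncovered h = C - f ` set h"

definition q :: "(nat \<Rightarrow> real) list \<Rightarrow> (nat \<Rightarrow> real) \<Rightarrow> real" where
  "q h x = pmf (Q h) x"

definition histories :: "nat \<Rightarrow> (nat \<Rightarrow> real) list set" where
  "histories t = {h. length h = t \<and> set h \<subseteq> X}"

lemma finite_histories: "finite (histories t)"
  using finite_lists_length_eq[OF finX, of t] by (simp add: histories_def conj_commute)

lemma finite_cluster [simp]: "finite (cluster c)"
  by (simp add: cluster_def finX)

lemma finite_uncovered [simp]: "finite (uncovered h)"
  by (simp add: uncovered_def finC)

lemma q_nonneg [simp]: "0 \<le> q h x"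
  by (simp add: q_def)

lemma D_nonneg: "h \<noteq> [] \<Longrightarrow> 0 \<le> D h x"
  by (simp add: D_def)

lemma D_snoc: "h \<noteq> [] \<Longrightarrow> D (h @ [y]) x = min (D h x) (sqdist d x y)"
  by (simp add: D_def Min_insert min.commute)

lemma D_triangle:
  assumes "h \<noteq> []"
  shows "D h x \<le> 2 * D h y + 2 * sqdist d x y"
proof -
  have "D h y \<in> sqdist d y ` set h" unfolding D_def using assms by (intro Min_in) auto
  then obtain c where c: "c \<in> set h" "D h y = sqdist d y c" by auto
  have "D h x \<le> sqdist d x c" unfolding D_def using c by (intro Min_le) auto
  then show ?thesis using sqdist_triangle[of d x c y] c by simp
qed

lemma cost_nonneg: "h \<noteq> [] \<Longrightarrow> 0 \<le> cost h c"
  by (simp add: cost_def sum_nonneg D_nonneg)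

lemma cost_snoc_le: "h \<noteq> [] \<Longrightarrow> cost (h @ [x]) c \<le> cost h c"
  unfolding cost_def by (intro sum_mono) (simp add: D_snoc)

lemma opt_nonneg: "0 \<le> opt c"
  by (simp add: opt_def sum_nonneg)

lemma sum_clusters: "(\<Sum>c\<in>C. \<Sum>x\<in>cluster c. g x) = (\<Sum>x\<in>X. g x)"
  unfolding cluster_def using sum.group[OF finX finC, of f g] fC by auto

lemma kmeans_cost_eq: "kmeans_cost d X (set h) = (\<Sum>c\<in>C. cost h c)"
  by (simp add: cost_def sum_clusters) (simp add: kmeans_cost_def D_def sqdist_def)

lemma q_sum:
  assumes "h \<in> histories t" "t < k"
  shows "(\<Sum>x\<in>X. q h x) = 1"
  unfolding q_def using assms adv finX
  by (intro sum_pmf_eq_1) (auto simp: noisy_adversary_def histories_def)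

lemma q_bounds:
  assumes "h \<in> histories t" "t < k" "h \<noteq> []" "(\<Sum>c\<in>C. cost h c) \<noteq> 0" "x \<in> X"
  shows "(1 - e1) * D h x / (\<Sum>c\<in>C. cost h c) \<le> q h x"
    and "q h x \<le> (1 + e2) * D h x / (\<Sum>c\<in>C. cost h c)"
proof -
  have "kmeans_cost d {x} (set h) = D h x" by (simp add: kmeans_cost_def D_def sqdist_def)
  then have *: "kmpp_prob d X h x = D h x / (\<Sum>c\<in>C. cost h c)"
    using assms by (simp add: kmpp_prob_def kmeans_cost_eq)
  have "(1 - e1) * kmpp_prob d X h x \<le> q h x \<and> q h x \<le> (1 + e2) * kmpp_prob d X h x"
    using adv assms by (auto simp: noisy_adversary_def histories_def q_def kmeans_cost_eq)
  then show "(1 - e1) * D h x / (\<Sum>c\<in>C. cost h c) \<le> q h x"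
    "q h x \<le> (1 + e2) * D h x / (\<Sum>c\<in>C. cost h c)"
    by (simp_all add: *)
qed

lemma q_bounds_first:
  assumes "0 < k" "x \<in> X"
  shows "(1 - e1) / card X \<le> q [] x" and "q [] x \<le> (1 + e2) / card X"
  using adv assms by (auto simp: noisy_adversary_def q_def kmpp_prob_def dest!: spec[of _ "[]"])

section \<open>Hitting a cluster, and the deposits\<close>

definition qC :: "(nat \<Rightarrow> real) list \<Rightarrow> (nat \<Rightarrow> real) \<Rightarrow> real" where
  "qC h c = (\<Sum>x\<in>cluster c. q h x)"

lemma qC_bounds:
  assumes "h \<in> histories t" "t < k" "h \<noteq> []" "(\<Sum>c\<in>C. cost h c) \<noteq> 0"
  shows "(1 - e1) * cost h c / (\<Sum>c\<in>C. cost h c) \<le> qC h c"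
    and "qC h c \<le> (1 + e2) * cost h c / (\<Sum>c\<in>C. cost h c)"
proof -
  let ?S = "\<Sum>c\<in>C. cost h c"
  have *: "z * cost h c / ?S = (\<Sum>x\<in>cluster c. z * D h x / ?S)" for z
    by (simp add: cost_def[of h c] sum_distrib_left sum_divide_distrib)
  show "(1 - e1) * cost h c / ?S \<le> qC h c" "qC h c \<le> (1 + e2) * cost h c / ?S"
    unfolding qC_def * using q_bounds[OF assms] by (auto intro!: sum_mono simp: cluster_def)
qed

lemma qC_nonneg: "0 \<le> qC h c"
  by (simp add: qC_def sum_nonneg)

lemma sum_qC: "(\<Sum>x\<in>X. q h x * g (f x)) = (\<Sum>c\<in>C. qC h c * g c)"
proof -
  have "(\<Sum>x\<in>X. q h x * g (f x)) = (\<Sum>c\<in>C. \<Sum>x\<in>cluster c. q h x * g (f x))"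
    by (simp add: sum_clusters)
  also have "\<dots> = (\<Sum>c\<in>C. qC h c * g c)"
    unfolding qC_def sum_distrib_right by (intro sum.cong) (auto simp: cluster_def)
  finally show ?thesis .
qed

text \<open>A deposit in expectation pays for the cost of its cluster at the step that hits it.\<close>

definition deposit :: "(nat \<Rightarrow> real) list \<Rightarrow> (nat \<Rightarrow> real) \<Rightarrow> real" where
  "deposit h c = (if c \<in> uncovered h then 16 * r * opt c else cost h c)"

text \<open>Conditioned on hitting cluster \<open>c\<close>, each point has at most \<open>r\<close>
  times its ideal probability: the point is bounded above with \<open>1 + e2\<close>, the cluster
  below with \<open>1 - e1\<close>. Uniform sampling costs a factor 4, later steps a factor
  16.\<close>

lemma hit_cost:
  assumes "h \<in> histories t" "t < k"
  shows "(\<Sum>x\<in>cluster c. q h x * cost (h @ [x]) c) \<le> 16 * r * opt c * qC h c"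
proof (cases "h = []")
  case True
  have k: "0 < k" using assms by simp
  show ?thesis
  proof (cases "cluster c = {}")
    case False
    define N where "N = real (card X)"
    have N: "N > 0" using False finX by (auto simp: N_def card_gt_0_iff cluster_def)
    have "(\<Sum>x\<in>cluster c. q h x * cost (h @ [x]) c)
        \<le> (\<Sum>x\<in>cluster c. (1 + e2) / N * (\<Sum>y\<in>cluster c. sqdist d x y))"
    proof (intro sum_mono)
      fix x assume x: "x \<in> cluster c"
      have *: "cost (h @ [x]) c = (\<Sum>y\<in>cluster c. sqdist d x y)"
        by (simp add: cost_def D_def True sqdist_commute)
      show "q h x * cost (h @ [x]) c \<le> (1 + e2) / N * (\<Sum>y\<in>cluster c. sqdist d x y)"
        unfolding * unfolding True N_def
        using q_bounds_first(2)[OF k, of x] x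
        by (intro mult_right_mono sum_nonneg) (auto simp: cluster_def)
    qed
    also have "\<dots> = (1 + e2) / N * (\<Sum>x\<in>cluster c. \<Sum>y\<in>cluster c. sqdist d x y)"
      by (simp add: sum_distrib_left)
    also have "\<dots> \<le> (1 + e2) / N * (4 * real (card (cluster c)) * opt c)"
      using sum_sqdist_pairs_le[of "cluster c" d c] N e2 unfolding opt_def
      by (intro mult_left_mono) auto
    also have "\<dots> = 4 * r * opt c * (\<Sum>x\<in>cluster c. (1 - e1) / N)"
      by (simp add: r_mult[symmetric])
    also have "\<dots> \<le> 4 * r * opt c * qC h c"
      unfolding qC_def using q_bounds_first(1)[OF k] r_ge True
      by (intro mult_left_mono sum_mono) (auto simp: N_def cluster_def opt_nonneg)
    also have "\<dots> \<le> 16 * r * opt c * qC h c"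
      using r_ge by (intro mult_right_mono) (auto simp: qC_nonneg opt_nonneg)
    finally show ?thesis .
  qed (simp add: qC_def)
next
  case h: False
  let ?S = "\<Sum>c\<in>C. cost h c"
  show ?thesis
  proof (cases "c \<in> C \<and> ?S \<noteq> 0")
    case True
    then have S: "?S > 0" using cost_nonneg[OF h] by (simp add: sum_nonneg less_le)
    have "(\<Sum>x\<in>cluster c. q h x * cost (h @ [x]) c)
        \<le> (\<Sum>x\<in>cluster c. (1 + e2) * D h x / ?S * cost (h @ [x]) c)"
      using q_bounds(2)[OF assms h] True
      by (intro sum_mono mult_right_mono) (auto simp: cluster_def cost_nonneg)
    also have "\<dots> = (1 + e2) / ?S * (\<Sum>x\<in>cluster c. D h x * cost (h @ [x]) c)"
      by (simp add: sum_distrib_left mult.assoc)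
    also have "\<dots> = (1 + e2) / ?S *
        (\<Sum>x\<in>cluster c. D h x * (\<Sum>y\<in>cluster c. min (D h y) (sqdist d y x)))"
      by (simp add: cost_def[of "h @ _"] D_snoc h)
    also have "\<dots> \<le> (1 + e2) / ?S * (16 * cost h c * opt c)"
      unfolding cost_def[of h c] opt_def using S e2 D_nonneg[OF h] D_triangle[OF h]
      by (intro mult_left_mono D2_sampling_cost) auto
    also have "\<dots> = 16 * r * opt c * ((1 - e1) * cost h c / ?S)"
      by (simp add: r_mult[symmetric])
    also have "\<dots> \<le> 16 * r * opt c * qC h c"
      using qC_bounds(1)[OF assms h] True r_ge by (intro mult_left_mono) (auto simp: opt_nonneg)
    finally show ?thesis .
  next
    case False
    \<comment> \<open>Either all costs vanish or the cluster is empty. A zero cost stays zero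
      whatever is chosen.\<close>
    have "cost h c = 0"
    proof (cases "c \<in> C")
      case True
      then show ?thesis using False sum_nonneg_eq_0_iff[OF finC] cost_nonneg[OF h] by auto
    next
      case False
      then have "cluster c = {}" using fC by (auto simp: cluster_def)
      then show ?thesis by (simp add: cost_def)
    qed
    then have "cost (h @ [x]) c = 0" for x
      using cost_snoc_le[OF h, of x c] cost_nonneg[of "h @ [x]" c] by simp
    then show ?thesis using r_ge by (simp add: opt_nonneg qC_nonneg)
  qed
qed

text \<open>A covered cluster only gets cheaper. For an uncovered one, \<open>hit_cost\<close> pays
  for the event of being hit, and otherwise the deposit is unchanged.\<close>

lemma deposit_step:
  assumes "h \<in> histories t" "t < k" "c \<in> C"
  shows "(\<Sum>x\<in>X. q h x * deposit (h @ [x]) c) \<le> deposit h c"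
proof (cases "c \<in> uncovered h")
  case False
  then have "h \<noteq> []" using assms(3) by (auto simp: uncovered_def)
  then have "deposit (h @ [x]) c \<le> deposit h c" for x
    using False cost_snoc_le by (simp add: deposit_def uncovered_def assms(3))
  then have "(\<Sum>x\<in>X. q h x * deposit (h @ [x]) c) \<le> (\<Sum>x\<in>X. q h x * deposit h c)"
    by (intro sum_mono mult_left_mono) auto
  also have "\<dots> = deposit h c"
    using q_sum[OF assms(1,2)] by (simp flip: sum_distrib_right)
  finally show ?thesis .
next
  case True
  have split: "(\<Sum>x\<in>X. g x) = (\<Sum>x\<in>cluster c. g x) + (\<Sum>x\<in>X - cluster c. g x)"
    for g :: "_ \<Rightarrow> real"
    using sum.subset_diff[of "cluster c" X g] finX by (auto simp: cluster_def)
  have 1: "deposit (h @ [x]) c = cost (h @ [x]) c" if "x \<in> cluster c" for x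
    using that by (auto simp: deposit_def uncovered_def cluster_def)
  have 2: "deposit (h @ [x]) c = 16 * r * opt c" if "x \<in> X - cluster c" for x
    using that True by (auto simp: deposit_def uncovered_def cluster_def)
  have "(\<Sum>x\<in>X. q h x * deposit (h @ [x]) c)
      = (\<Sum>x\<in>cluster c. q h x * cost (h @ [x]) c) + (\<Sum>x\<in>X - cluster c. q h x) * (16 * r * opt c)"
    unfolding split[of "\<lambda>x. q h x * deposit (h @ [x]) c"] sum_distrib_right
    by (simp add: 1 2)
  also have "\<dots> \<le> 16 * r * opt c * qC h c + (\<Sum>x\<in>X - cluster c. q h x) * (16 * r * opt c)"
    using hit_cost[OF assms(1,2)] by simp
  also have "\<dots> = 16 * r * opt c * (\<Sum>x\<in>X. q h x)"
    unfolding split[of "q h"] qC_def by (simp add: algebra_simps)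
  finally show ?thesis using True q_sum[OF assms(1,2)] by (simp add: deposit_def)
qed

section \<open>Growth of the average cost of uncovered clusters\<close>

text \<open>The level \<open>a\<close> is a parameter because it stays frozen at an earlier average
  while \<open>h\<close> grows.\<close>

definition high :: "real \<Rightarrow> (nat \<Rightarrow> real) list \<Rightarrow> (nat \<Rightarrow> real) set" where
  "high a h = {c \<in> uncovered h. cost h c > 2 * r * a}"

definition low :: "real \<Rightarrow> (nat \<Rightarrow> real) list \<Rightarrow> (nat \<Rightarrow> real) set" where
  "low a h = {c \<in> uncovered h. cost h c \<le> 2 * a}"

text \<open>The added 1 keeps the denominator positive. Removing one of \<open>L\<close> low
  clusters multiplies the value by \<open>(L + 1) / L\<close>, that is, adds
  \<open>pot a h / L\<close>.\<close>

definition pot :: "real \<Rightarrow> (nat \<Rightarrow> real) list \<Rightarrow> real" where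
  "pot a h = (\<Sum>c\<in>high a h. cost h c) / (card (low a h) + 1)"

text \<open>Equal to 0 once every cluster is covered, since division by 0 yields 0.\<close>

definition avg :: "(nat \<Rightarrow> real) list \<Rightarrow> real" where
  "avg h = (\<Sum>c\<in>uncovered h. cost h c) / card (uncovered h)"

lemma finite_high_low [simp]: "finite (high a h)" "finite (low a h)"
  by (simp_all add: high_def low_def)

lemma pot_nonneg: "h \<noteq> [] \<Longrightarrow> 0 \<le> pot a h"
  by (simp add: pot_def sum_nonneg cost_nonneg)

lemma avg_nonneg: "h \<noteq> [] \<Longrightarrow> 0 \<le> avg h"
  by (simp add: avg_def sum_nonneg cost_nonneg)

lemma high_snoc: "h \<noteq> [] \<Longrightarrow> high a (h @ [x]) \<subseteq> high a h - {f x}"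
  by (auto simp: high_def uncovered_def dest: order_less_le_trans[OF _ cost_snoc_le])

lemma low_snoc: "h \<noteq> [] \<Longrightarrow> low a h - {f x} \<subseteq> low a (h @ [x])"
  by (auto simp: low_def uncovered_def intro: order_trans[OF cost_snoc_le])

lemma sum_high_snoc:
  assumes "h \<noteq> []"
  shows "(\<Sum>c\<in>high a (h @ [x]). cost (h @ [x]) c)
    \<le> (\<Sum>c\<in>high a h. cost h c) - of_bool (f x \<in> high a h) * cost h (f x)"
proof -
  have "(\<Sum>c\<in>high a (h @ [x]). cost (h @ [x]) c) \<le> (\<Sum>c\<in>high a (h @ [x]). cost h c)"
    by (intro sum_mono cost_snoc_le assms)
  also have "\<dots> \<le> (\<Sum>c\<in>high a h - {f x}. cost h c)"
    using assms by (intro sum_mono2 high_snoc cost_nonneg) auto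
  also have "\<dots> = (\<Sum>c\<in>high a h. cost h c) - of_bool (f x \<in> high a h) * cost h (f x)"
    by (simp add: sum_diff1)
  finally show ?thesis .
qed

text \<open>A repeat leaves the set of uncovered clusters unchanged, and falling costs can only
  shrink \<open>high\<close> and enlarge \<open>low\<close>. This handles the one step at which the
  level is fixed, before \<open>pot_step\<close> takes over.\<close>

lemma pot_repeat:
  assumes "h \<noteq> []" "f x \<in> f ` set h"
  shows "pot a (h @ [x]) \<le> pot a h"
proof -
  have fx: "f x \<notin> high a h" "f x \<notin> low a h" using assms by (auto simp: high_def low_def uncovered_def)
  have "card (low a h) \<le> card (low a (h @ [x]))"
    using low_snoc[OF assms(1), of a x] fx by (intro card_mono) auto
  then show ?thesis unfolding pot_def
    using sum_high_snoc[OF assms(1), of x a] fx assms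
    by (intro frac_le) (auto simp: sum_nonneg cost_nonneg)
qed

text \<open>The bound depends on \<open>x\<close> only through \<open>f x\<close>, so its mean
  becomes a sum over clusters weighted by \<open>qC\<close>.\<close>

lemma pot_snoc_le:
  assumes "h \<noteq> []" "0 \<le> a"
  shows "pot a (h @ [x]) \<le> pot a h
    - of_bool (f x \<in> high a h) * cost h (f x) / (card (low a h) + 1)
    + of_bool (f x \<in> low a h) * pot a h / card (low a h)"
proof -
  define G where "G = (\<Sum>c\<in>high a h. cost h c)"
  define G' where "G' = (\<Sum>c\<in>high a (h @ [x]). cost (h @ [x]) c)"
  define L where "L = card (low a h)"
  define L' where "L' = card (low a (h @ [x]))"
  have G': "G' \<le> G - of_bool (f x \<in> high a h) * cost h (f x)" "0 \<le> G'"
    using sum_high_snoc[OF assms(1), of x a] by (auto simp: G_def G'_def sum_nonneg cost_nonneg)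
  have G0: "0 \<le> G" using assms(1) by (auto simp: G_def sum_nonneg cost_nonneg)
  have p: "pot a h = G / (real L + 1)" "pot a (h @ [x]) = G' / (real L' + 1)"
    by (simp_all add: pot_def G_def G'_def L_def L'_def)
  show ?thesis
  proof (cases "f x \<in> low a h")
    case True
    have "a \<le> r * a" using mult_right_mono[OF r_ge(2) assms(2)] by simp
    then have nh: "f x \<notin> high a h" using True by (auto simp: high_def low_def)
    have L: "L > 0" using True by (auto simp: L_def card_gt_0_iff)
    have "L - 1 \<le> L'" unfolding L_def L'_def
      using card_mono[OF _ low_snoc[OF assms(1), of a x]] True by simp
    then have "real L \<le> real L' + 1" by linarith
    then have "pot a (h @ [x]) \<le> G / real L" unfolding p
      using G' G0 nh L by (intro frac_le) auto
    also have "\<dots> = pot a h + pot a h / real L" 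
      unfolding p using L by (simp add: divide_simps) (simp add: algebra_simps)
    finally show ?thesis using True nh by (simp add: L_def)
  next
    case False
    have "L \<le> L'" unfolding L_def L'_def
      using low_snoc[OF assms(1), of a x] False by (intro card_mono) auto
    then have "pot a (h @ [x]) \<le> (G - of_bool (f x \<in> high a h) * cost h (f x)) / (real L + 1)"
      unfolding p using G' by (intro frac_le) auto
    then show ?thesis using False by (simp add: p L_def diff_divide_distrib add.commute)
  qed
qed

text \<open>Hitting low clusters raises the mean by at most a common probability bound times
  \<open>pot a h\<close>; hitting high clusters lowers it by at least as much.\<close>

lemma pot_step:
  assumes "h \<in> histories t" "t < k" "h \<noteq> []" "0 \<le> a"
  shows "(\<Sum>x\<in>X. q h x * pot a (h @ [x])) \<le> pot a h"
proof -
  let ?S = "\<Sum>c\<in>C. cost h c"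
  define L where "L = real (card (low a h))"
  define G where "G = (\<Sum>c\<in>high a h. cost h c)"
  have L0: "0 \<le> L" by (simp add: L_def)
  have G0: "0 \<le> G" using assms(3) by (auto simp: G_def sum_nonneg cost_nonneg)
  have potG: "pot a h = G / (L + 1)" by (simp add: pot_def G_def L_def add.commute)
  have sub: "high a h \<subseteq> C" "low a h \<subseteq> C" by (auto simp: high_def low_def uncovered_def)
  show ?thesis
  \<comment> \<open>With zero total cost the adversary is unconstrained, but then the potential is 0
    and stays 0.\<close>
  proof (cases "?S = 0")
    case True
    then have "cost h c = 0" if "c \<in> C" for c
      using that sum_nonneg_eq_0_iff[OF finC] cost_nonneg[OF assms(3)] by auto
    then have "G = 0" unfolding G_def using sub by (intro sum.neutral) auto
    then have p0: "pot a h = 0" by (simp add: potG)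
    have "pot a (h @ [x]) \<le> 0" for x
    proof -
      have "(\<Sum>c\<in>high a (h @ [x]). cost (h @ [x]) c) \<le> 0"
        using sum_high_snoc[OF assms(3), of x a] \<open>G = 0\<close> cost_nonneg[OF assms(3), of "f x"]
        unfolding G_def by (cases "f x \<in> high a h") auto
      then show ?thesis by (simp add: pot_def divide_nonpos_pos)
    qed
    then show ?thesis unfolding p0 by (intro sum_nonpos) (simp add: mult_nonneg_nonpos)
  next
    case False
    then have S: "?S > 0" using cost_nonneg[OF assms(3)] by (simp add: sum_nonneg less_le)
    define g where "g c = pot a h - of_bool (c \<in> high a h) * cost h c / (L + 1)
        + of_bool (c \<in> low a h) * pot a h / L" for c
    have "(\<Sum>x\<in>X. q h x * pot a (h @ [x])) \<le> (\<Sum>x\<in>X. q h x * g (f x))"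
      using pot_snoc_le[OF assms(3,4)]
      by (intro sum_mono mult_left_mono) (auto simp: g_def L_def add.commute)
    also have "\<dots> = (\<Sum>c\<in>C. qC h c * g c)" by (rule sum_qC)
    also have "\<dots> = (\<Sum>c\<in>C. qC h c) * pot a h
        - (\<Sum>c\<in>C. of_bool (c \<in> high a h) * (qC h c * cost h c)) / (L + 1)
        + (\<Sum>c\<in>C. of_bool (c \<in> low a h) * qC h c) * (pot a h / L)"
      unfolding g_def sum_distrib_right sum_divide_distrib
      by (simp add: sum_subtractf[symmetric] sum.distrib[symmetric] algebra_simps)
    also have "(\<Sum>c\<in>C. qC h c) = 1"
      using q_sum[OF assms(1,2)] sum_qC[of h "\<lambda>_. 1"] by simp
    also have "(\<Sum>c\<in>C. of_bool (c \<in> high a h) * (qC h c * cost h c)) = (\<Sum>c\<in>high a h. qC h c * cost h c)"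
      using sub finC by (intro sum.mono_neutral_cong_right) auto
    also have "(\<Sum>c\<in>C. of_bool (c \<in> low a h) * qC h c) = (\<Sum>c\<in>low a h. qC h c)"
      using sub finC by (intro sum.mono_neutral_cong_right) auto
    finally have main: "(\<Sum>x\<in>X. q h x * pot a (h @ [x])) \<le> pot a h
        - (\<Sum>c\<in>high a h. qC h c * cost h c) / (L + 1) + (\<Sum>c\<in>low a h. qC h c) * (pot a h / L)"
      by simp
    \<comment> \<open>An upper bound for the probability of each low cluster and a lower bound for
      that of each high one; the two agree because of the gap \<open>r\<close> between the
      thresholds.\<close>
    let ?K = "(1 + e2) * (2 * a) / ?S"
    have "(\<Sum>c\<in>low a h. qC h c) \<le> (\<Sum>c\<in>low a h. ?K)"
    proof (intro sum_mono)
      fix c assume "c \<in> low a h"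
      then have "(1 + e2) * cost h c / ?S \<le> ?K"
        using S e2 by (intro divide_right_mono mult_left_mono) (auto simp: low_def)
      then show "qC h c \<le> ?K" using qC_bounds(2)[OF assms(1,2,3) False, of c] by simp
    qed
    then have lo: "(\<Sum>c\<in>low a h. qC h c) \<le> L * ?K" by (simp add: L_def)
    have "(\<Sum>c\<in>high a h. ?K * cost h c) \<le> (\<Sum>c\<in>high a h. qC h c * cost h c)"
    proof (intro sum_mono mult_right_mono cost_nonneg assms)
      fix c assume "c \<in> high a h"
      then have "(1 - e1) * (2 * r * a) / ?S \<le> (1 - e1) * cost h c / ?S"
        using S e1 by (intro divide_right_mono mult_left_mono) (auto simp: high_def)
      moreover have "(1 - e1) * (2 * r * a) = (1 + e2) * (2 * a)" by (simp flip: r_mult)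
      ultimately show "?K \<le> qC h c" using qC_bounds(1)[OF assms(1,2,3) False, of c] by simp
    qed
    then have hi: "?K * G \<le> (\<Sum>c\<in>high a h. qC h c * cost h c)"
      by (simp add: G_def sum_distrib_left)
    have "(\<Sum>c\<in>low a h. qC h c) * (pot a h / L) \<le> L * ?K * (pot a h / L)"
      using lo L0 pot_nonneg[OF assms(3)] by (intro mult_right_mono) auto
    \<comment> \<open>Not an equality, since for \<open>L = 0\<close> the quotient
      \<open>pot a h / L\<close> is 0.\<close>
    also have "\<dots> \<le> ?K * pot a h"
      using S e2 assms(4) pot_nonneg[OF assms(3)] by (cases "L = 0") auto
    also have "\<dots> = ?K * G / (L + 1)" by (simp add: potG)
    also have "\<dots> \<le> (\<Sum>c\<in>high a h. qC h c * cost h c) / (L + 1)"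
      using hi L0 by (intro divide_right_mono) auto
    finally show ?thesis using main by simp
  qed
qed

text \<open>Uncovered clusters outside \<open>high\<close> cost at most \<open>2 * r * a\<close>.
  With u \<ge> 1 uncovered clusters the denominator of the potential is at most u + 1 \<le> 2 u,
  which gives the factor 2.\<close>

lemma avg_le_pot:
  assumes "h \<noteq> []" "0 \<le> a"
  shows "avg h \<le> 2 * r * a + 2 * pot a h"
proof (cases "uncovered h = {}")
  case True
  then show ?thesis using assms r_ge pot_nonneg by (simp add: avg_def)
next
  case False
  define u where "u = real (card (uncovered h))"
  define G where "G = (\<Sum>c\<in>high a h. cost h c)"
  have "card (uncovered h) \<noteq> 0" using False by simp
  then have u: "u \<ge> 1" unfolding u_def by linarith
  have G0: "0 \<le> G" using assms(1) by (auto simp: G_def sum_nonneg cost_nonneg)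
  have "(\<Sum>c\<in>uncovered h. cost h c)
      \<le> (\<Sum>c\<in>uncovered h. 2 * r * a + of_bool (c \<in> high a h) * cost h c)"
    using assms r_ge by (intro sum_mono) (auto simp: high_def)
  also have "\<dots> = u * (2 * r * a) + G"
  proof -
    have "(\<Sum>c\<in>uncovered h. of_bool (c \<in> high a h) * cost h c) = G"
      unfolding G_def by (intro sum.mono_neutral_cong_right) (auto simp: high_def)
    then show ?thesis by (simp add: sum.distrib u_def)
  qed
  finally have "avg h \<le> (u * (2 * r * a) + G) / u"
    unfolding avg_def u_def by (intro divide_right_mono) auto
  also have "\<dots> = 2 * r * a + G / u" using u by (simp add: add_divide_distrib)
  also have "G / u \<le> 2 * pot a h"
  proof -
    have "card (low a h) \<le> card (uncovered h)" by (intro card_mono) (auto simp: low_def)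
    then have "real (card (low a h)) + 1 \<le> 2 * u" using u unfolding u_def by linarith
    then have "2 * G / (2 * u) \<le> 2 * G / (real (card (low a h)) + 1)"
      using G0 by (intro frac_le) auto
    then show ?thesis by (simp add: pot_def G_def add.commute)
  qed
  finally show ?thesis by simp
qed

text \<open>Markov's inequality: at most half of the uncovered clusters cost more than twice their
  average, so the denominator is at least half their number.\<close>

lemma pot_avg_le:
  assumes "h \<noteq> []"
  shows "pot (avg h) h \<le> 2 * avg h"
proof (cases "uncovered h = {}")
  case True
  then show ?thesis using assms avg_nonneg by (simp add: pot_def high_def)
next
  case False
  define u where "u = real (card (uncovered h))"
  define a where "a = avg h"
  define L where "L = real (card (low a h))"
  have "card (uncovered h) \<noteq> 0" using False by simp
  then have u: "u \<ge> 1" unfolding u_def by linarith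
  have ua: "(\<Sum>c\<in>uncovered h. cost h c) = u * a" using u by (simp add: a_def avg_def u_def)
  have a0: "0 \<le> a" unfolding a_def by (rule avg_nonneg[OF assms])
  have lu: "low a h \<subseteq> uncovered h" by (auto simp: low_def)
  have nl: "real (card (uncovered h - low a h)) = u - L"
    using card_mono[OF _ lu] by (simp add: card_Diff_subset lu u_def L_def of_nat_diff)
  have "u \<le> 2 * L + 2"
  proof (cases "a = 0")
    case True
    then have "\<forall>c\<in>uncovered h. cost h c = 0"
      using ua sum_nonneg_eq_0_iff[of "uncovered h" "cost h"] cost_nonneg[OF assms] by simp
    then have "low a h = uncovered h" using True by (auto simp: low_def)
    then show ?thesis using u by (simp add: L_def u_def)
  next
    case False
    have "(u - L) * (2 * a) = (\<Sum>c\<in>uncovered h - low a h. 2 * a)" by (simp add: nl)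
    also have "\<dots> \<le> (\<Sum>c\<in>uncovered h - low a h. cost h c)"
      by (intro sum_mono) (auto simp: low_def)
    also have "\<dots> \<le> (\<Sum>c\<in>uncovered h. cost h c)"
      using assms by (intro sum_mono2) (auto simp: cost_nonneg)
    finally have "a * (2 * (u - L)) \<le> a * u" by (simp add: ua mult_ac)
    then show ?thesis using False a0 by (simp add: mult_le_cancel_left)
  qed
  moreover have "(\<Sum>c\<in>high a h. cost h c) \<le> u * a"
    unfolding ua[symmetric] using assms by (intro sum_mono2) (auto simp: high_def cost_nonneg)
  ultimately have "pot a h \<le> (2 * L + 2) * a / (L + 1)"
    unfolding pot_def L_def using a0
    by (intro frac_le) (auto intro: order_trans mult_right_mono simp: L_def sum_nonneg add.commute)
  also have "\<dots> = 2 * a"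
  proof -
    have "(2 * L + 2) * a = 2 * a * (L + 1)" by (simp add: algebra_simps)
    moreover have "L + 1 \<noteq> 0" by (simp add: L_def)
    ultimately show ?thesis by (metis nonzero_mult_div_cancel_right)
  qed
  finally show ?thesis by (simp add: a_def)
qed

section \<open>Expectations over histories\<close>

abbreviation E :: "nat \<Rightarrow> ((nat \<Rightarrow> real) list \<Rightarrow> real) \<Rightarrow> real" where
  "E t g \<equiv> measure_pmf.expectation (sample_centers Q t) g"

lemma set_sample_centers: "t \<le> k \<Longrightarrow> set_pmf (sample_centers Q t) \<subseteq> histories t"
proof (induction t)
  case (Suc t)
  have "set_pmf (Q h) \<subseteq> X" if "h \<in> histories t" for h
    using that adv Suc.prems by (auto simp: noisy_adversary_def histories_def)
  with Suc show ?case by (force simp: histories_def)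
qed (simp add: histories_def)

lemma integrable_sample_centers:
  fixes g :: "(nat \<Rightarrow> real) list \<Rightarrow> real"
  assumes "t \<le> k"
  shows "integrable (measure_pmf (sample_centers Q t)) g"
  using finite_subset[OF set_sample_centers[OF assms] finite_histories]
  by (rule integrable_measure_pmf_finite)

lemma E_mono:
  assumes "t \<le> k" "\<And>h. h \<in> histories t \<Longrightarrow> g h \<le> g' h"
  shows "E t g \<le> E t g'"
  using set_sample_centers[OF assms(1)] assms(2)
  by (intro integral_mono_AE integrable_sample_centers assms(1)) (auto simp: AE_measure_pmf_iff)

lemma E_Suc:
  assumes "t < k"
  shows "E (Suc t) g = E t (\<lambda>h. \<Sum>x\<in>X. q h x * g (h @ [x]))"
proof -
  have sub: "set_pmf (Q h) \<subseteq> X" if "h \<in> histories t" for h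
    using that adv assms by (auto simp: noisy_adversary_def histories_def)
  have "E (Suc t) g = (\<Sum>h\<in>histories t. pmf (sample_centers Q t) h
      * measure_pmf.expectation (map_pmf (\<lambda>x. h @ [x]) (Q h)) g)"
    using assms sub finX unfolding sample_centers.simps
    by (subst pmf_expectation_bind[OF finite_histories]) (auto intro: finite_subset dest: subsetD[OF set_sample_centers, rotated])
  also have "\<dots> = (\<Sum>h\<in>histories t. pmf (sample_centers Q t) h * (\<Sum>x\<in>X. q h x * g (h @ [x])))"
    using sub by (intro sum.cong refl arg_cong2[where f = "(*)"])
      (subst integral_map_pmf, subst integral_measure_pmf[OF finX], auto simp: q_def)
  also have "\<dots> = E t (\<lambda>h. \<Sum>x\<in>X. q h x * g (h @ [x]))"
    using set_sample_centers[of t] assms by (subst integral_measure_pmf[OF finite_histories]) auto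
  finally show ?thesis .
qed

text \<open>The start time \<open>t\<close> is free because a charge is determined by the history
  only after its own step.\<close>

lemma E_supermartingale:
  assumes "\<And>s h. t \<le> s \<Longrightarrow> s < k \<Longrightarrow> h \<in> histories s \<Longrightarrow> (\<Sum>x\<in>X. q h x * g (h @ [x])) \<le> g h"
    and "t \<le> t'" "t' \<le> k"
  shows "E t' g \<le> E t g"
  using assms(2,3)
proof (induction t' rule: dec_induct)
  case (step s)
  have "E (Suc s) g \<le> E s g"
    unfolding E_Suc[OF Suc_le_lessD[OF step.prems]] using step assms(1) by (intro E_mono) auto
  then show ?case using step by simp
qed simp

section \<open>Charging the uncovered cost to the repeats\<close>

definition deposits :: "(nat \<Rightarrow> real) list \<Rightarrow> real" where
  "deposits h = (\<Sum>c\<in>C. deposit h c)"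

text \<open>Deposits are a supermartingale, and initially every cluster is uncovered.\<close>

lemma E_deposits:
  assumes "t \<le> k"
  shows "E t deposits \<le> 16 * r * (\<Sum>c\<in>C. opt c)"
proof -
  have "E t deposits \<le> E 0 deposits"
  proof (rule E_supermartingale)
    fix s h assume s: "s < k" "h \<in> histories s"
    have "(\<Sum>x\<in>X. q h x * deposits (h @ [x])) = (\<Sum>c\<in>C. \<Sum>x\<in>X. q h x * deposit (h @ [x]) c)"
      unfolding deposits_def sum_distrib_left by (rule sum.swap)
    also have "\<dots> \<le> deposits h"
      unfolding deposits_def by (intro sum_mono deposit_step[OF s(2,1)])
    finally show "(\<Sum>x\<in>X. q h x * deposits (h @ [x])) \<le> deposits h" .
  qed (use assms in auto)
  also have "\<dots> = deposits []" by simp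
  also have "\<dots> = 16 * r * (\<Sum>c\<in>C. opt c)"
    by (simp add: deposits_def deposit_def uncovered_def sum_distrib_left)
  finally show ?thesis .
qed

lemma covered_le_deposits:
  assumes "h \<noteq> []"
  shows "(\<Sum>c\<in>C - uncovered h. cost h c) \<le> deposits h"
proof -
  have "(\<Sum>c\<in>C - uncovered h. cost h c) = (\<Sum>c\<in>C - uncovered h. deposit h c)"
    by (simp add: deposit_def)
  also have "\<dots> \<le> deposits h"
    unfolding deposits_def using finC assms r_ge
    by (intro sum_mono2) (auto simp: deposit_def cost_nonneg opt_nonneg)
  finally show ?thesis .
qed

lemma f_set: "h \<in> histories t \<Longrightarrow> f ` set h \<subseteq> C"
  using fC by (auto simp: histories_def)

lemma card_uncovered:
  assumes "h \<in> histories t"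
  shows "card (uncovered h) = k - card (f ` set h)"
  unfolding uncovered_def using card_Diff_subset[OF _ f_set[OF assms]] cardC by simp

definition repeats :: "(nat \<Rightarrow> real) list \<Rightarrow> (nat \<Rightarrow> real) \<Rightarrow> bool" where
  "repeats h x \<longleftrightarrow> f x \<in> f ` set h"

text \<open>The total cost, if nonzero, cancels: a repeat has probability at most
  \<open>1 + e2\<close> times the covered share of the cost, and the average is an uncovered cost of
  at most the total, divided by at least \<open>k - t\<close> clusters.\<close>

lemma repeat_charge:
  assumes "h \<in> histories t" "t < k" "h \<noteq> []"
  shows "(\<Sum>x\<in>X. q h x * of_bool (repeats h x)) * avg h \<le> (1 + e2) / real (k - t) * deposits h"
proof -
  let ?S = "\<Sum>c\<in>C. cost h c"
  define H where "H = (\<Sum>c\<in>C - uncovered h. cost h c)"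
  define U where "U = (\<Sum>c\<in>uncovered h. cost h c)"
  define u where "u = real (card (uncovered h))"
  have HU: "?S = H + U" unfolding H_def U_def
    by (rule sum.subset_diff) (auto simp: uncovered_def finC)
  have H0: "0 \<le> H" and U0: "0 \<le> U" using assms(3) by (auto simp: H_def U_def sum_nonneg cost_nonneg)
  have "card (f ` set h) \<le> t"
    using card_image_le[of "set h" f] card_length[of h] assms(1) by (simp add: histories_def)
  then have u: "real (k - t) \<le> u" "0 < real (k - t)"
    using assms(2) card_uncovered[OF assms(1)] by (auto simp: u_def)
  have Hd: "H \<le> deposits h" unfolding H_def by (rule covered_le_deposits[OF assms(3)])
  have avg: "avg h = U / u" by (simp add: avg_def U_def u_def)
  show ?thesis
  proof (cases "?S = 0")
    case True
    then have "U = 0" using HU H0 U0 by simp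
    then show ?thesis using Hd H0 e2 u by (simp add: avg)
  next
    case False
    then have S: "?S > 0" using HU H0 U0 by simp
    have "(\<Sum>x\<in>X. q h x * of_bool (repeats h x)) = (\<Sum>c\<in>C. qC h c * of_bool (c \<in> f ` set h))"
      unfolding repeats_def by (rule sum_qC)
    also have "\<dots> = (\<Sum>c\<in>C - uncovered h. qC h c)"
      using finC by (intro sum.mono_neutral_cong_right) (auto simp: uncovered_def)
    also have "\<dots> \<le> (\<Sum>c\<in>C - uncovered h. (1 + e2) * cost h c / ?S)"
      by (intro sum_mono qC_bounds[OF assms False])
    also have "\<dots> = (1 + e2) * H / ?S" by (simp add: H_def sum_distrib_left sum_divide_distrib)
    finally have "(\<Sum>x\<in>X. q h x * of_bool (repeats h x)) * avg h \<le> (1 + e2) * H / ?S * avg h"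
      using avg_nonneg[OF assms(3)] by (rule mult_right_mono)
    also have "\<dots> = (1 + e2) * H / u * (U / ?S)" by (simp add: avg)
    also have "\<dots> \<le> (1 + e2) * H / u * 1"
      using HU H0 U0 S e2 u by (intro mult_left_mono) auto
    also have "\<dots> \<le> (1 + e2) * deposits h / real (k - t)"
      using u e2 H0 Hd by (simp only: mult_1_right, intro frac_le mult_left_mono) auto
    finally show ?thesis by simp
  qed
qed

text \<open>Bounds the average cost of an uncovered cluster after \<open>h\<close> if step \<open>t\<close> is a repeat
  (steps count from 0).\<close>

definition charge :: "nat \<Rightarrow> (nat \<Rightarrow> real) list \<Rightarrow> real" where
  "charge t h = of_bool (repeats (take t h) (h ! t))
     * (2 * r * avg (take t h) + 2 * pot (avg (take t h)) h)"

text \<open>After step \<open>t\<close> the level is frozen, so \<open>pot_step\<close> brings the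
  expectation back to time \<open>Suc t\<close>. There \<open>repeat_charge\<close> and
  \<open>E_deposits\<close> apply; 96 is 6 * 16.\<close>

lemma E_charge:
  assumes "1 \<le> t" "t < k"
  shows "E k (charge t) \<le> 96 * r\<^sup>2 * (1 + e2) * (\<Sum>c\<in>C. opt c) / real (k - t)"
proof -
  have "E k (charge t) \<le> E (Suc t) (charge t)"
  proof (rule E_supermartingale)
    fix s h assume s: "Suc t \<le> s" "s < k" "h \<in> histories s"
    then have len: "length h = s" by (simp add: histories_def)
    define w where "w = (of_bool (repeats (take t h) (h ! t)) :: real)"
    define a where "a = avg (take t h)"
    have h: "h \<noteq> []" "take t h \<noteq> []" using s len assms by auto
    have "(\<Sum>x\<in>X. q h x * charge t (h @ [x])) = (\<Sum>x\<in>X. q h x * (w * (2 * r * a + 2 * pot a (h @ [x]))))"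
      using s len by (intro sum.cong) (simp_all add: charge_def w_def a_def nth_append)
    also have "\<dots> = w * (2 * r * a * (\<Sum>x\<in>X. q h x) + 2 * (\<Sum>x\<in>X. q h x * pot a (h @ [x])))"
      by (simp add: sum_distrib_left sum.distrib algebra_simps)
    also have "\<dots> \<le> w * (2 * r * a + 2 * pot a h)"
      using pot_step[OF s(3,2) h(1) avg_nonneg[OF h(2)]] q_sum[OF s(3,2)]
      by (intro mult_left_mono) (auto simp: w_def a_def)
    finally show "(\<Sum>x\<in>X. q h x * charge t (h @ [x])) \<le> charge t h"
      by (simp add: charge_def w_def a_def)
  qed (use assms in auto)
  also have "\<dots> = E t (\<lambda>h. \<Sum>x\<in>X. q h x * charge t (h @ [x]))" by (rule E_Suc[OF assms(2)])
  also have "\<dots> \<le> E t (\<lambda>h. 6 * r * (1 + e2) / real (k - t) * deposits h)"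
  proof (rule E_mono)
    fix h assume h: "h \<in> histories t"
    then have len: "length h = t" "h \<noteq> []" using assms by (auto simp: histories_def)
    have "(\<Sum>x\<in>X. q h x * charge t (h @ [x])) \<le> (\<Sum>x\<in>X. q h x * (of_bool (repeats h x) * (6 * r * avg h)))"
    proof (intro sum_mono mult_left_mono q_nonneg)
      fix x
      \<comment> \<open>The coefficient is \<open>2 * r + 2 * 2 \<le> 6 * r\<close>, the last 2
        being that of \<open>pot_avg_le\<close>.\<close>
      have "2 * r * avg h + 2 * pot (avg h) (h @ [x]) \<le> 6 * r * avg h" if "repeats h x"
      proof -
        have "pot (avg h) (h @ [x]) \<le> 2 * avg h"
          using pot_repeat[OF len(2)] that pot_avg_le[OF len(2)] by (auto simp: repeats_def intro: order_trans)
        moreover have "avg h \<le> r * avg h"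
          using mult_right_mono[OF r_ge(2) avg_nonneg[OF len(2)]] by simp
        ultimately show ?thesis by simp
      qed
      then show "charge t (h @ [x]) \<le> of_bool (repeats h x) * (6 * r * avg h)"
        using len by (auto simp: charge_def nth_append)
    qed
    also have "\<dots> = 6 * r * ((\<Sum>x\<in>X. q h x * of_bool (repeats h x)) * avg h)"
      by (simp add: sum_distrib_left sum_distrib_right mult_ac)
    also have "\<dots> \<le> 6 * r * ((1 + e2) / real (k - t) * deposits h)"
      using repeat_charge[OF h assms(2) len(2)] r_ge by (intro mult_left_mono) auto
    finally show "(\<Sum>x\<in>X. q h x * charge t (h @ [x])) \<le> 6 * r * (1 + e2) / real (k - t) * deposits h"
      by simp
  qed (use assms in simp)
  also have "\<dots> = 6 * r * (1 + e2) / real (k - t) * E t deposits" by simp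
  also have "\<dots> \<le> 6 * r * (1 + e2) / real (k - t) * (16 * r * (\<Sum>c\<in>C. opt c))"
    using E_deposits[of t] assms r_ge e2 by (intro mult_left_mono) auto
  finally show ?thesis by (simp add: power2_eq_square mult_ac)
qed

text \<open>There are finally as many uncovered clusters as repeats, so each repeat bears one final
  average. By \<open>avg_le_pot\<close>, with the level frozen at the repeat, its charge covers
  this.\<close>

lemma cost_le_charges:
  assumes "h \<in> histories k" "k \<ge> 1"
  shows "kmeans_cost d X (set h) \<le> deposits h + (\<Sum>t\<in>{1..<k}. charge t h)"
proof -
  have len: "length h = k" "h \<noteq> []" using assms by (auto simp: histories_def)
  define w where "w t = (of_bool (repeats (take t h) (h ! t)) :: nat)" for t
  have "card (f ` set h) + (\<Sum>t<k. w t) = k"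
    using card_image_add_repeats[of f h] len by (simp add: w_def repeats_def)
  then have "card (uncovered h) = (\<Sum>t<k. w t)"
    using card_uncovered[OF assms(1)] by linarith
  \<comment> \<open>Step 0 is never a repeat, as nothing has been hit before it.\<close>
  also have "\<dots> = (\<Sum>t\<in>{1..<k}. w t)"
    by (rule sum.mono_neutral_right) (auto simp: w_def repeats_def Suc_le_eq)
  finally have u: "real (card (uncovered h)) = (\<Sum>t\<in>{1..<k}. real (w t))" by simp
  have "(\<Sum>c\<in>uncovered h. cost h c) = real (card (uncovered h)) * avg h"
    by (cases "uncovered h = {}") (auto simp: avg_def)
  also have "\<dots> = (\<Sum>t\<in>{1..<k}. real (w t) * avg h)" by (simp add: u sum_distrib_right)
  also have "\<dots> \<le> (\<Sum>t\<in>{1..<k}. charge t h)"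
  proof (rule sum_mono)
    fix t assume t: "t \<in> {1..<k}"
    then have "take t h \<noteq> []" using len by auto
    then show "real (w t) * avg h \<le> charge t h"
      using avg_le_pot[OF len(2) avg_nonneg] by (simp add: charge_def w_def)
  qed
  finally have "(\<Sum>c\<in>uncovered h. cost h c) \<le> (\<Sum>t\<in>{1..<k}. charge t h)" .
  moreover have "(\<Sum>c\<in>C. cost h c) = (\<Sum>c\<in>C - uncovered h. cost h c) + (\<Sum>c\<in>uncovered h. cost h c)"
    by (rule sum.subset_diff) (auto simp: uncovered_def finC)
  ultimately show ?thesis
    unfolding kmeans_cost_eq using covered_le_deposits[OF len(2)] by simp
qed

lemma E_cost:
  assumes "k \<ge> 2"
  shows "E k (\<lambda>h. kmeans_cost d X (set h)) \<le> r ^ 3 * (112 + 96 * ln (real k)) * (\<Sum>c\<in>C. opt c)"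
proof -
  let ?O = "\<Sum>c\<in>C. opt c"
  have O0: "0 \<le> ?O" by (simp add: sum_nonneg opt_nonneg)
  have lnk: "0 \<le> 1 + ln (real k)" using assms by (simp add: add_nonneg_nonneg)
  have "E k (\<lambda>h. kmeans_cost d X (set h)) \<le> E k (\<lambda>h. deposits h + (\<Sum>t\<in>{1..<k}. charge t h))"
    using assms by (intro E_mono cost_le_charges) auto
  also have "\<dots> = E k deposits + (\<Sum>t\<in>{1..<k}. E k (charge t))"
    by (simp add: integrable_sample_centers)
  also have "\<dots> \<le> 16 * r * ?O + (\<Sum>t\<in>{1..<k}. 96 * r\<^sup>2 * (1 + e2) * ?O / real (k - t))"
    by (intro add_mono sum_mono E_deposits E_charge) auto
  also have "(\<Sum>t\<in>{1..<k}. 96 * r\<^sup>2 * (1 + e2) * ?O / real (k - t)) = 96 * r\<^sup>2 * (1 + e2) * ?O * harm (k - 1)"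
    unfolding harm_def sum_distrib_left
    by (rule sum.reindex_bij_witness[of _ "\<lambda>j. k - j" "\<lambda>j. k - j"]) (auto simp: divide_inverse)
  also have "\<dots> \<le> 96 * r\<^sup>2 * r * ?O * (1 + ln (real k))"
  proof (intro mult_mono)
    \<comment> \<open>The harmonic number minus the logarithm decreases from its value 1 at argument
      1; index \<open>k - 2\<close> stands for argument \<open>k - 1\<close>.\<close>
    have "harm (k - 1) \<le> ln (real (k - 1)) + (1 :: real)"
      using decseqD[OF decseq_harm_diff_ln, of 0 "k - 2"] assms
      by (simp add: harm_expand Suc_diff_Suc numeral_2_eq_2)
    also have "\<dots> \<le> ln (real k) + 1" using assms by simp
    finally show "harm (k - 1) \<le> 1 + ln (real k)" by simp
  qed (use r_ge e2 O0 in \<open>auto simp: harm_nonneg\<close>)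
  also have "16 * r * ?O + 96 * r\<^sup>2 * r * ?O * (1 + ln (real k)) \<le> 16 * r ^ 3 * ?O + 96 * r\<^sup>2 * r * ?O * (1 + ln (real k))"
    using power_increasing[of 1 3 r] r_ge O0 lnk by (intro add_mono mult_right_mono) auto
  also have "\<dots> = r ^ 3 * (112 + 96 * ln (real k)) * ?O"
    by (simp add: power3_eq_cube power2_eq_square algebra_simps)
  finally show ?thesis by simp
qed

end

section \<open>Passing to the optimal cost\<close>

text \<open>Makes the infimum in \<open>kmeans_opt\<close> meaningful: in positive dimension the
  space contains a whole coordinate axis and is infinite.\<close>

lemma center_sets_nonempty:
  assumes "d \<ge> 1"
  shows "{C. C \<subseteq> topspace (Euclidean_space d) \<and> finite C \<and> card C = k} \<noteq> {}"
proof -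
  have "infinite (topspace (Euclidean_space d))"
  proof
    assume "finite (topspace (Euclidean_space d))"
    moreover have "range (\<lambda>a i. if i = (0::nat) then a else 0) \<subseteq> topspace (Euclidean_space d)"
      using assms by (auto simp: topspace_Euclidean_space)
    moreover have "inj (\<lambda>(a::real) i. if i = (0::nat) then a else 0)"
      by (auto intro!: injI dest: fun_cong[of _ _ 0])
    ultimately show False
      using infinite_UNIV_char_0[where 'a = real] finite_subset finite_imageD by blast
  qed
  then show ?thesis using infinite_arbitrarily_large[of _ k] by blast
qed

lemma kmeans_opt_nonneg:
  assumes "d \<ge> 1" "k \<ge> 1"
  shows "0 \<le> kmeans_opt d k X"
  unfolding kmeans_opt_def
proof (rule cINF_greatest[OF center_sets_nonempty[OF assms(1)]])
  fix C assume "C \<in> {C. C \<subseteq> topspace (Euclidean_space d) \<and> finite C \<and> card C = k}"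
  then have "finite C" "C \<noteq> {}" using assms(2) by auto
  then show "0 \<le> kmeans_cost d X C" unfolding kmeans_cost_def by (intro sum_nonneg) simp
qed

text \<open>The bound holds against every set of \<open>k\<close> centers, so it passes to the
  infimum without exhibiting a minimizer.\<close>

lemma noisy_kmpp_cost_le:
  assumes "k \<ge> 2" "finite X" "0 \<le> e1" "e1 < 1" "0 \<le> e2" "noisy_adversary d k e1 e2 X Q" "d \<ge> 1"
  shows "measure_pmf.expectation (noisy_kmpp Q k) (kmeans_cost d X)
    \<le> ((1 + e2) / (1 - e1)) ^ 3 * (112 + 96 * ln (real k)) * kmeans_opt d k X"
proof -
  define K where "K = ((1 + e2) / (1 - e1)) ^ 3 * (112 + 96 * ln (real k))"
  define \<C> where "\<C> = {C. C \<subseteq> topspace (Euclidean_space d) \<and> finite C \<and> card C = k}"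
  have K: "K > 0" unfolding K_def using assms by (intro mult_pos_pos add_pos_nonneg) auto
  let ?E = "measure_pmf.expectation (noisy_kmpp Q k) (kmeans_cost d X)"
  have le: "?E \<le> K * kmeans_cost d X C" if "C \<in> \<C>" for C
  proof -
    have C: "finite C" "card C = k" "C \<noteq> {}" using that assms(1) by (auto simp: \<C>_def)
    \<comment> \<open>Nearest centers make the sum of \<open>opt\<close> over \<open>C\<close> equal
      to the cost of \<open>C\<close>.\<close>
    define f where "f x = arg_min_on (sqdist d x) C" for x
    have f: "f x \<in> C" "\<And>c. c \<in> C \<Longrightarrow> sqdist d x (f x) \<le> sqdist d x c" for x
      using arg_min_if_finite[OF C(1,3)] arg_min_least[OF C(1,3)] by (auto simp: f_def)
    interpret noisy_seeding d k X e1 e2 Q C f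
      using assms C f by unfold_locales auto
    have "(MIN c\<in>C. sqdist d x c) = sqdist d x (f x)" for x
      using f C by (intro Min_eqI) auto
    then have "kmeans_cost d X C = (\<Sum>x\<in>X. sqdist d x (f x))"
      by (simp add: kmeans_cost_def flip: sqdist_def)
    also have "\<dots> = (\<Sum>c\<in>C. \<Sum>x\<in>cluster c. sqdist d x (f x))" by (simp add: sum_clusters)
    also have "\<dots> = (\<Sum>c\<in>C. opt c)"
      unfolding opt_def by (intro sum.cong) (auto simp: cluster_def)
    finally show ?thesis
      using E_cost[OF assms(1)] by (simp add: noisy_kmpp_def K_def r_def)
  qed
  have "\<C> \<noteq> {}" unfolding \<C>_def by (rule center_sets_nonempty[OF assms(7)])
  then have "?E / K \<le> (INF C\<in>\<C>. kmeans_cost d X C)"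
    using le K by (intro cINF_greatest) (auto simp: pos_divide_le_eq mult.commute)
  then show ?thesis using K unfolding kmeans_opt_def \<C>_def[symmetric] K_def[symmetric]
    by (simp add: pos_divide_le_eq mult.commute)
qed

section \<open>Small k, and the final constant\<close>

text \<open>As \<open>(e1 + e2) / (1 - e1) = r - 1\<close>, the threshold is at most
  \<open>24 * r\<^sup>2\<close>. Hence \<open>k\<close> is bounded polynomially in \<open>r\<close>,
  and logarithms can be compared.\<close>

lemma ln_k_le_of_threshold:
  assumes "k \<ge> 2" "0 \<le> e1" "e1 < 1" "0 \<le> e2" "real k / ln (real k) \<le> noise_threshold e1 e2"
  shows "ln (real k) \<le> 100 * log_factor ((1 + e2) / (1 - e1))"
proof -
  define r where "r = (1 + e2) / (1 - e1)"
  define s where "s = sqrt (real k)"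
  have r: "r \<ge> 1" using assms by (simp add: r_def pos_le_divide_eq)
  have s: "s > 0" "real k = s\<^sup>2" using assms by (simp_all add: s_def)
  have "1 < real k" using assms(1) by simp
  then have L: "ln (real k) > 0" by simp
  have "(e1 + e2) * (1 + e2) / (1 - e1)\<^sup>2 = (r - 1) * r"
    using assms by (simp add: r_def field_simps power2_eq_square)
  moreover have "(r - 1) * r \<le> r\<^sup>2" using r by (simp add: power2_eq_square algebra_simps)
  moreover have "24 * (e1 + e2) * (1 + e2) / (1 - e1)\<^sup>2 = 24 * ((e1 + e2) * (1 + e2) / (1 - e1)\<^sup>2)"
    by simp
  ultimately have "24 * (e1 + e2) * (1 + e2) / (1 - e1)\<^sup>2 \<le> 24 * r\<^sup>2" by linarith
  moreover have "18 \<le> 24 * r\<^sup>2" using power_mono[OF r, of 2] by simp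
  ultimately have "real k / ln (real k) \<le> 24 * r\<^sup>2"
    using assms(5) by (simp add: noise_threshold_def)
  then have "s\<^sup>2 \<le> 24 * r\<^sup>2 * ln (real k)" using L by (simp add: s pos_divide_le_eq)
  \<comment> \<open>Passing to the square root, \<open>ln s \<le> s\<close> uses up only one of the
    two factors \<open>s\<close> on the left.\<close>
  also have "ln (real k) = 2 * ln s" using s by (simp add: ln_realpow)
  also have "24 * r\<^sup>2 * (2 * ln s) \<le> 24 * r\<^sup>2 * (2 * s)"
    using ln_bound[of s] s by (intro mult_left_mono) auto
  finally have "s * s \<le> s * (48 * r\<^sup>2)" by (simp add: power2_eq_square mult_ac)
  then have "s \<le> 48 * r\<^sup>2" using s by (simp add: mult_le_cancel_left)
  then have "ln s \<le> ln (48 * r\<^sup>2)" using s r by simp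
  also have "\<dots> = ln 48 + 2 * ln r" using r by (simp add: ln_mult ln_realpow)
  finally have "ln (real k) \<le> 2 * ln 48 + 4 * ln r" using s by (simp add: ln_realpow)
  \<comment> \<open>A crude bound suffices: 100 is 2 * 48 + 4.\<close>
  moreover have "ln 48 \<le> (48 :: real)" by (rule ln_bound) simp
  ultimately show ?thesis unfolding log_factor_def r_def[symmetric] by simp
qed

theorem theorem2:
  "\<exists>c::real. c > 0 \<and>
     (\<forall>(d::nat) (k::nat) (X::(nat \<Rightarrow> real) set) (\<epsilon>\<^sub>1::real) (\<epsilon>\<^sub>2::real)
        (Q::(nat \<Rightarrow> real) list \<Rightarrow> (nat \<Rightarrow> real) pmf).
        d \<ge> 1 \<and> k \<ge> 2 \<and> finite X \<and> X \<subseteq> topspace (Euclidean_space d) \<and>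
        0 \<le> \<epsilon>\<^sub>1 \<and> \<epsilon>\<^sub>1 < 1 \<and> 0 \<le> \<epsilon>\<^sub>2 \<and> noisy_adversary d k \<epsilon>\<^sub>1 \<epsilon>\<^sub>2 X Q \<longrightarrow>
        (real k / ln (real k) \<ge> noise_threshold \<epsilon>\<^sub>1 \<epsilon>\<^sub>2 \<longrightarrow>
           measure_pmf.expectation (noisy_kmpp Q k) (\<lambda>T. kmeans_cost d X T)
             \<le> c * ((1 + \<epsilon>\<^sub>2) / (1 - \<epsilon>\<^sub>1)) ^ 3 * (ln (real k))\<^sup>2 * kmeans_opt d k X) \<and>
        (real k / ln (real k) \<le> noise_threshold \<epsilon>\<^sub>1 \<epsilon>\<^sub>2 \<longrightarrow>
           measure_pmf.expectation (noisy_kmpp Q k) (\<lambda>T. kmeans_cost d X T)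
             \<le> c * ((1 + \<epsilon>\<^sub>2) / (1 - \<epsilon>\<^sub>1)) ^ 4
                 * (log_factor ((1 + \<epsilon>\<^sub>2) / (1 - \<epsilon>\<^sub>1)))\<^sup>2 * kmeans_opt d k X))"
proof (intro exI[of _ "9712"] conjI allI impI; (elim conjE)?)
  fix d k X \<epsilon>\<^sub>1 \<epsilon>\<^sub>2 Q
  assume d: "(d::nat) \<ge> 1" and k: "(k::nat) \<ge> 2" and X: "finite (X :: (nat \<Rightarrow> real) set)"
    and e: "0 \<le> \<epsilon>\<^sub>1" "\<epsilon>\<^sub>1 < 1" "0 \<le> \<epsilon>\<^sub>2" and Q: "noisy_adversary d k \<epsilon>\<^sub>1 \<epsilon>\<^sub>2 X Q"
  let ?E = "measure_pmf.expectation (noisy_kmpp Q k) (kmeans_cost d X)"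
  define r where "r = (1 + \<epsilon>\<^sub>2) / (1 - \<epsilon>\<^sub>1)"
  define L where "L = ln (real k)"
  define \<Lambda> where "\<Lambda> = log_factor r"
  have r: "r \<ge> 1" using e by (simp add: r_def pos_le_divide_eq)
  \<comment> \<open>A lower bound on \<open>L\<close>, attained in essence at \<open>k = 2\<close>,
    lets \<open>L\<^sup>2\<close> absorb both the constant and the linear term.\<close>
  have "2 / 3 \<le> ln (2::real)" by (rule ln2_ge_two_thirds)
  also have "\<dots> \<le> L" using k by (simp add: L_def)
  finally have L: "2 / 3 \<le> L" .
  have \<Lambda>: "1 \<le> \<Lambda>" by (simp add: \<Lambda>_def log_factor_def)
  have bound: "?E \<le> r ^ 3 * (112 + 96 * L) * kmeans_opt d k X"
    using noisy_kmpp_cost_le[OF k X e Q d] by (simp add: r_def L_def)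
  have opt: "0 \<le> kmeans_opt d k X" using d k by (intro kmeans_opt_nonneg) auto
  have LL: "L \<le> 3 / 2 * L\<^sup>2" using mult_right_mono[OF L, of L] L by (simp add: power2_eq_square)
  have "r ^ 3 * (112 + 96 * L) \<le> r ^ 3 * (9712 * L\<^sup>2)"
    using r L LL by (intro mult_left_mono) auto
  from mult_right_mono[OF this opt]
  have "r ^ 3 * (112 + 96 * L) * kmeans_opt d k X \<le> 9712 * r ^ 3 * L\<^sup>2 * kmeans_opt d k X"
    by (simp only: mult_ac)
  then show "?E \<le> 9712 * ((1 + \<epsilon>\<^sub>2) / (1 - \<epsilon>\<^sub>1)) ^ 3 * (ln (real k))\<^sup>2 * kmeans_opt d k X"
    using bound by (simp add: r_def L_def)
  assume "real k / ln (real k) \<le> noise_threshold \<epsilon>\<^sub>1 \<epsilon>\<^sub>2"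
  then have "L \<le> 100 * \<Lambda>"
    using ln_k_le_of_threshold[OF k e] by (simp add: L_def \<Lambda>_def r_def)
  moreover have "\<Lambda> \<le> \<Lambda>\<^sup>2" "1 \<le> \<Lambda>\<^sup>2" using \<Lambda> mult_mono[OF \<Lambda> \<Lambda>] by (simp_all add: power2_eq_square)
  \<comment> \<open>This case fixes the constant of the theorem: 9712 = 112 + 96 * 100.\<close>
  ultimately have "112 + 96 * L \<le> 9712 * \<Lambda>\<^sup>2" by simp
  moreover have "r ^ 3 \<le> r ^ 4" using r by (intro power_increasing) auto
  ultimately have "r ^ 3 * (112 + 96 * L) \<le> r ^ 4 * (9712 * \<Lambda>\<^sup>2)"
    using r L by (intro mult_mono) auto
  from mult_right_mono[OF this opt]
  have "r ^ 3 * (112 + 96 * L) * kmeans_opt d k X \<le> 9712 * r ^ 4 * \<Lambda>\<^sup>2 * kmeans_opt d k X"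
    by (simp only: mult_ac)
  then show "?E \<le> 9712 * ((1 + \<epsilon>\<^sub>2) / (1 - \<epsilon>\<^sub>1)) ^ 4
      * (log_factor ((1 + \<epsilon>\<^sub>2) / (1 - \<epsilon>\<^sub>1)))\<^sup>2 * kmeans_opt d k X"
    using bound by (simp add: r_def \<Lambda>_def)
qed simp

end
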